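(* (1) The commuting incompressible families $\mathcal{F}=(f_i)_{i\in I}\subseteq X^X$ on a set $X$ consist, up to isomorphism, of the abelian group structures on $X$ together with a choice of an $I$-indexed tuple of elements thereof which generate the group as a monoid. (2) The group in part (1) can be recovered as the automorphism group $$\mathrm{Aut}(\mathcal{F}):=\{\sigma\in\Sigma_X \mid \sigma f=f\sigma,\ \forall f\in\mathcal{F}\}$$ of the structure $(X,\mathcal{F})$.
   Context: $X^X$ is the set of functions $X\to X$ and $\Sigma_X$ is the group of permutations of $X$. A family $\mathcal{F}$ of functions $X\to X$ is commuting if any two of its members commute under composition, and incompressible if there is no non-empty proper subset $J\subsetneq X$ with $f(J)\subseteq J$ for all $f\in\mathcal{F}$. Two families $(f_i)_{i\in I}$, $(g_i)_{i\in I}$ of functions $X\to X$ are isomorphic if there is $\sigma\in\Sigma_X$ with $\sigma\circ f_i=g_i\circ\sigma$ for all $i\in I$. Two structures $(\Gamma,(\gamma_i)_{i\in I})$ and $(\Gamma',(\gamma_i')_{i\in I})$, each consisting of a group structure on $X$ and a tuple of elements generating it as a monoid, are isomorphic if there is a group isomorphism $\Gamma\cong\Gamma'$ sending $\gamma_i$ to $\gamma_i'$ for every $i\in I$. A tuple generates a group as a monoid if the smallest submonoid containing its entries is the whole group. In the correspondence of (1), the family attached to $(\Gamma,(\gamma_i)_{i\in I})$ consists of the translations $f_i$ of $X=\Gamma$ by the elements $\gamma_i$; in (2), the elements of $\mathrm{Aut}(\mathcal{F})$ are the translations by elements of the group. *)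

theory Defs
  imports "HOL-Algebra.Bij"
begin

(* As in HOL-Algebra.Bij, a function from X to X is represented extensionally, i.e. as an
   element of X \<rightarrow>\<^sub>E X, so that equality in HOL is equality of functions on X.  Families and
   tuples over I are total functions whose values outside I are never used; I may be empty. *)

definition self_map_family :: "'a set \<Rightarrow> 'i set \<Rightarrow> ('i \<Rightarrow> 'a \<Rightarrow> 'a) \<Rightarrow> bool" where
  "self_map_family X I f \<longleftrightarrow> (\<forall>i\<in>I. f i \<in> X \<rightarrow>\<^sub>E X)"

definition commuting :: "'a set \<Rightarrow> 'i set \<Rightarrow> ('i \<Rightarrow> 'a \<Rightarrow> 'a) \<Rightarrow> bool" where
  "commuting X I f \<longleftrightarrow> (\<forall>i\<in>I. \<forall>j\<in>I. compose X (f i) (f j) = compose X (f j) (f i))"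

definition incompressible :: "'a set \<Rightarrow> 'i set \<Rightarrow> ('i \<Rightarrow> 'a \<Rightarrow> 'a) \<Rightarrow> bool" where
  "incompressible X I f \<longleftrightarrow> \<not> (\<exists>J. J \<noteq> {} \<and> J \<subset> X \<and> (\<forall>i\<in>I. f i ` J \<subseteq> J))"

definition commuting_incompressible :: "'a set \<Rightarrow> 'i set \<Rightarrow> ('i \<Rightarrow> 'a \<Rightarrow> 'a) \<Rightarrow> bool" where
  "commuting_incompressible X I f \<longleftrightarrow>
     self_map_family X I f \<and> commuting X I f \<and> incompressible X I f"

definition isomorphic_families ::
    "'a set \<Rightarrow> 'i set \<Rightarrow> ('i \<Rightarrow> 'a \<Rightarrow> 'a) \<Rightarrow> ('i \<Rightarrow> 'a \<Rightarrow> 'a) \<Rightarrow> bool" where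
  "isomorphic_families X I f g \<longleftrightarrow>
     (\<exists>\<sigma>\<in>Bij X. \<forall>i\<in>I. compose X \<sigma> (f i) = compose X (g i) \<sigma>)"

definition generates_as_monoid ::
    "('a, 'b) monoid_scheme \<Rightarrow> 'i set \<Rightarrow> ('i \<Rightarrow> 'a) \<Rightarrow> bool" where
  "generates_as_monoid \<Gamma> I \<gamma> \<longleftrightarrow> \<Inter>{S. submonoid S \<Gamma> \<and> \<gamma> ` I \<subseteq> S} = carrier \<Gamma>"

definition generated_abelian_group_on ::
    "'a set \<Rightarrow> 'i set \<Rightarrow> 'a monoid \<Rightarrow> ('i \<Rightarrow> 'a) \<Rightarrow> bool" where
  "generated_abelian_group_on X I \<Gamma> \<gamma> \<longleftrightarrow>
     comm_group \<Gamma> \<and> carrier \<Gamma> = X \<and> \<gamma> \<in> I \<rightarrow> carrier \<Gamma> \<and> generates_as_monoid \<Gamma> I \<gamma>"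

definition isomorphic_generated_groups ::
    "'i set \<Rightarrow> 'a monoid \<Rightarrow> ('i \<Rightarrow> 'a) \<Rightarrow> 'a monoid \<Rightarrow> ('i \<Rightarrow> 'a) \<Rightarrow> bool" where
  "isomorphic_generated_groups I \<Gamma> \<gamma> \<Gamma>' \<gamma>' \<longleftrightarrow> (\<exists>h\<in>iso \<Gamma> \<Gamma>'. \<forall>i\<in>I. h (\<gamma> i) = \<gamma>' i)"

definition translation :: "('a, 'b) monoid_scheme \<Rightarrow> 'a \<Rightarrow> 'a \<Rightarrow> 'a" where
  "translation \<Gamma> a = (\<lambda>x\<in>carrier \<Gamma>. a \<otimes>\<^bsub>\<Gamma>\<^esub> x)"

definition translation_family ::
    "('a, 'b) monoid_scheme \<Rightarrow> ('i \<Rightarrow> 'a) \<Rightarrow> 'i \<Rightarrow> 'a \<Rightarrow> 'a" where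
  "translation_family \<Gamma> \<gamma> = (\<lambda>i. translation \<Gamma> (\<gamma> i))"

definition Aut :: "'a set \<Rightarrow> 'i set \<Rightarrow> ('i \<Rightarrow> 'a \<Rightarrow> 'a) \<Rightarrow> ('a \<Rightarrow> 'a) set" where
  "Aut X I f = {\<sigma> \<in> Bij X. \<forall>i\<in>I. compose X \<sigma> (f i) = compose X (f i) \<sigma>}"

definition Aut_group :: "'a set \<Rightarrow> 'i set \<Rightarrow> ('i \<Rightarrow> 'a \<Rightarrow> 'a) \<Rightarrow> ('a \<Rightarrow> 'a) monoid" where
  "Aut_group X I f = BijGroup X \<lparr>carrier := Aut X I f\<rparr>"

end

theory Submission
  imports Defs
begin

text \<open>The monoid \<open>M\<close> generated by a commuting incompressible family acts transitively, because an
  orbit is a non-empty invariant set.  Since \<open>M\<close> is commutative, an element of \<open>M\<close> is determined by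
  its value at a single point \<open>x\<^sub>0\<close>, so \<open>m \<mapsto> m(x\<^sub>0)\<close> is a bijection from \<open>M\<close> onto \<open>X\<close>; it
  transports the composition of \<open>M\<close> to an abelian group structure on \<open>X\<close> for which the family
  consists of translations.  A map that intertwines the translations by
  generators intertwines all translations, and is therefore a homomorphism followed by a translation;
  for automorphisms of the family the homomorphism is the identity.\<close>

section \<open>Pointwise forms of isomorphism and automorphism\<close>

text \<open>\<open>compose X\<close> is \<open>undefined\<close> off \<open>X\<close> for both
  composites, so only the points of \<open>X\<close> can distinguish them.\<close>

lemma compose_eq_iff:
  "compose X a b = compose X c d \<longleftrightarrow> (\<forall>x\<in>X. a (b x) = c (d x))"
  by (auto simp: compose_def restrict_def fun_eq_iff)

lemma isomorphic_families_iff: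
  "isomorphic_families X I f g \<longleftrightarrow> (\<exists>\<sigma>\<in>Bij X. \<forall>i\<in>I. \<forall>x\<in>X. \<sigma> (f i x) = g i (\<sigma> x))"
  by (simp add: isomorphic_families_def compose_eq_iff)

lemma mem_Aut_iff:
  "\<sigma> \<in> Aut X I f \<longleftrightarrow> \<sigma> \<in> Bij X \<and> (\<forall>i\<in>I. \<forall>x\<in>X. \<sigma> (f i x) = f i (\<sigma> x))"
  by (simp add: Aut_def compose_eq_iff)

lemma Aut_cong:
  assumes "\<And>i. i \<in> I \<Longrightarrow> f i = g i"
  shows "Aut X I f = Aut X I g"
  using assms by (auto simp: Aut_def)

lemma isomorphic_families_refl:
  assumes "self_map_family X I f" and "\<And>i. i \<in> I \<Longrightarrow> f i = g i"
  shows "isomorphic_families X I f g"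
  unfolding isomorphic_families_iff
proof (intro bexI ballI)
  show "(\<lambda>x\<in>X. x) \<in> Bij X"
    by (simp add: id_Bij)
  fix i x assume "i \<in> I" "x \<in> X"
  moreover have "f i x \<in> X"
    using assms(1) calculation by (auto simp: self_map_family_def PiE_iff)
  ultimately show "(\<lambda>x\<in>X. x) (f i x) = g i ((\<lambda>x\<in>X. x) x)"
    using assms(2) by simp
qed

lemma isomorphic_families_cong:
  assumes "\<And>i. i \<in> I \<Longrightarrow> f i = f' i"
  shows "isomorphic_families X I f g \<longleftrightarrow> isomorphic_families X I f' g"
  using assms by (simp add: isomorphic_families_def)


subsection \<open>Translation families\<close>

text \<open>This serves as induction over the generated monoid: a property holds throughout \<Gamma>
  once the elements having it form a submonoid containing the generators.\<close>

lemma submonoid_eq_carrier: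
  assumes "generates_as_monoid \<Gamma> I \<gamma>" and "submonoid S \<Gamma>" and "\<gamma> ` I \<subseteq> S"
  shows "S = carrier \<Gamma>"
proof
  show "S \<subseteq> carrier \<Gamma>"
    by (rule submonoid.subset[OF assms(2)])
  show "carrier \<Gamma> \<subseteq> S"
    using assms unfolding generates_as_monoid_def by blast
qed

lemma translation_family_apply:
  "x \<in> carrier \<Gamma> \<Longrightarrow> translation_family \<Gamma> \<gamma> i x = \<gamma> i \<otimes>\<^bsub>\<Gamma>\<^esub> x"
  by (simp add: translation_family_def translation_def)

lemma translation_apply:
  "x \<in> carrier \<Gamma> \<Longrightarrow> translation \<Gamma> a x = a \<otimes>\<^bsub>\<Gamma>\<^esub> x"
  by (simp add: translation_def)

lemma translation_in_Bij:
  assumes "group \<Gamma>" and a: "a \<in> carrier \<Gamma>"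
  shows "translation \<Gamma> a \<in> Bij (carrier \<Gamma>)"
proof -
  interpret group \<Gamma> by fact
  have "bij_betw (translation \<Gamma> a) (carrier \<Gamma>) (carrier \<Gamma>)"
  proof (rule bij_betwI[where g = "\<lambda>x. inv\<^bsub>\<Gamma>\<^esub> a \<otimes>\<^bsub>\<Gamma>\<^esub> x"])
    fix x assume "x \<in> carrier \<Gamma>"
    then show "inv\<^bsub>\<Gamma>\<^esub> a \<otimes>\<^bsub>\<Gamma>\<^esub> translation \<Gamma> a x = x"
      and "translation \<Gamma> a (inv\<^bsub>\<Gamma>\<^esub> a \<otimes>\<^bsub>\<Gamma>\<^esub> x) = x"
      using a by (simp_all add: translation_apply m_assoc[symmetric])
  qed (use a in \<open>auto simp: translation_apply\<close>)
  then show ?thesis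
    by (simp add: Bij_def translation_def)
qed

text \<open>For an invariant \<open>J\<close>, the elements whose translation preserves
  \<open>J\<close> form a submonoid containing the generators, hence are all of \<Gamma>; a group
  acts transitively on itself, so a non-empty \<open>J\<close> is everything.\<close>

lemma translation_family_commuting_incompressible:
  assumes "generated_abelian_group_on X I \<Gamma> \<gamma>"
  shows "commuting_incompressible X I (translation_family \<Gamma> \<gamma>)"
proof -
  from assms interpret comm_group \<Gamma>
    by (simp add: generated_abelian_group_on_def)
  from assms have X: "X = carrier \<Gamma>" and \<gamma>: "\<And>i. i \<in> I \<Longrightarrow> \<gamma> i \<in> carrier \<Gamma>"
    and gen: "generates_as_monoid \<Gamma> I \<gamma>"
    by (auto simp: generated_abelian_group_on_def)
  have "self_map_family X I (translation_family \<Gamma> \<gamma>)"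
    using \<gamma> by (auto simp: self_map_family_def X translation_family_def translation_def)
  moreover have "commuting X I (translation_family \<Gamma> \<gamma>)"
    using \<gamma> by (auto simp: commuting_def X compose_eq_iff translation_family_apply m_lcomm)
  moreover have "J = X" if J: "J \<noteq> {}" "J \<subseteq> X"
    and inv: "\<forall>i\<in>I. translation_family \<Gamma> \<gamma> i ` J \<subseteq> J" for J
  proof -
    let ?S = "{a \<in> carrier \<Gamma>. \<forall>j\<in>J. a \<otimes>\<^bsub>\<Gamma>\<^esub> j \<in> J}"
    have JX: "j \<in> carrier \<Gamma>" if "j \<in> J" for j
      using that J X by auto
    have "submonoid ?S \<Gamma>"
      by unfold_locales (auto simp: JX m_assoc)
    moreover have "\<gamma> i \<otimes>\<^bsub>\<Gamma>\<^esub> j \<in> J" if "i \<in> I" "j \<in> J" for i j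
      using inv that translation_family_apply[OF JX[OF that(2)]] by (metis image_subset_iff)
    then have "\<gamma> ` I \<subseteq> ?S"
      using \<gamma> by auto
    ultimately have S: "?S = carrier \<Gamma>"
      by (rule submonoid_eq_carrier[OF gen])
    obtain j where j: "j \<in> J"
      using J by auto
    have "x \<in> J" if "x \<in> carrier \<Gamma>" for x
    proof -
      \<comment> \<open>Translation by this element carries the chosen point \<open>j\<close> of
        \<open>J\<close> to \<open>x\<close>.\<close>
      have "x \<otimes>\<^bsub>\<Gamma>\<^esub> inv\<^bsub>\<Gamma>\<^esub> j \<in> ?S"
        unfolding S using that j JX by simp
      then have "x \<otimes>\<^bsub>\<Gamma>\<^esub> inv\<^bsub>\<Gamma>\<^esub> j \<otimes>\<^bsub>\<Gamma>\<^esub> j \<in> J"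
        using j by blast
      then show ?thesis
        using that j JX by (simp add: m_assoc)
    qed
    then show ?thesis
      using J X by auto
  qed
  ultimately show ?thesis
    unfolding commuting_incompressible_def incompressible_def by blast
qed

text \<open>Commutation with the generating translations extends to all translations. An
  automorphism \<sigma> is then fixed by its value at the identity, and commutativity of \<Gamma>
  identifies it with the translation by that value.\<close>

lemma translation_iso_Aut_group:
  assumes "generated_abelian_group_on X I \<Gamma> \<gamma>"
  shows "translation \<Gamma> \<in> iso \<Gamma> (Aut_group X I (translation_family \<Gamma> \<gamma>))"
proof -
  from assms interpret comm_group \<Gamma>
    by (simp add: generated_abelian_group_on_def)
  from assms have X: "X = carrier \<Gamma>" and \<gamma>: "\<And>i. i \<in> I \<Longrightarrow> \<gamma> i \<in> carrier \<Gamma>"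
    and gen: "generates_as_monoid \<Gamma> I \<gamma>"
    by (auto simp: generated_abelian_group_on_def)
  let ?A = "Aut X I (translation_family \<Gamma> \<gamma>)"
  have bij: "translation \<Gamma> a \<in> Bij X" if "a \<in> carrier \<Gamma>" for a
    using translation_in_Bij[OF is_group that] X by simp
  have Aut: "translation \<Gamma> a \<in> ?A" if "a \<in> carrier \<Gamma>" for a
    using that bij \<gamma>
    by (auto simp: mem_Aut_iff X translation_apply translation_family_apply m_lcomm)
  have mult: "translation \<Gamma> (a \<otimes>\<^bsub>\<Gamma>\<^esub> b) = compose X (translation \<Gamma> a) (translation \<Gamma> b)"
    if "a \<in> carrier \<Gamma>" "b \<in> carrier \<Gamma>" for a b
    using that by (auto simp: fun_eq_iff compose_def translation_def X m_assoc)
  have surj: "\<sigma> \<in> translation \<Gamma> ` carrier \<Gamma>" if "\<sigma> \<in> ?A" for \<sigma>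
  proof -
    have ext: "\<sigma> \<in> extensional (carrier \<Gamma>)"
      and \<sigma>: "\<And>x. x \<in> carrier \<Gamma> \<Longrightarrow> \<sigma> x \<in> carrier \<Gamma>"
      using that by (auto simp: mem_Aut_iff X Bij_def bij_betw_def)
    have comm: "\<sigma> (\<gamma> i \<otimes>\<^bsub>\<Gamma>\<^esub> x) = \<gamma> i \<otimes>\<^bsub>\<Gamma>\<^esub> \<sigma> x" if "i \<in> I" "x \<in> carrier \<Gamma>" for i x
      using \<open>\<sigma> \<in> ?A\<close> that \<sigma> by (simp add: mem_Aut_iff X translation_family_apply)
    \<comment> \<open>The elements whose translation commutes with \<sigma>; \<open>comm\<close>
      places the generators among them.\<close>
    let ?S = "{a \<in> carrier \<Gamma>. \<forall>x\<in>carrier \<Gamma>. \<sigma> (a \<otimes>\<^bsub>\<Gamma>\<^esub> x) = a \<otimes>\<^bsub>\<Gamma>\<^esub> \<sigma> x}"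
    have "submonoid ?S \<Gamma>"
      by unfold_locales (auto simp: \<sigma> m_assoc)
    moreover have "\<gamma> ` I \<subseteq> ?S"
      using \<gamma> comm by auto
    ultimately have S: "?S = carrier \<Gamma>"
      by (rule submonoid_eq_carrier[OF gen])
    have eq: "\<sigma> x = \<sigma> \<one>\<^bsub>\<Gamma>\<^esub> \<otimes>\<^bsub>\<Gamma>\<^esub> x" if x: "x \<in> carrier \<Gamma>" for x
    proof -
      have "x \<in> ?S"
        unfolding S by (rule x)
      then have "\<sigma> (x \<otimes>\<^bsub>\<Gamma>\<^esub> \<one>\<^bsub>\<Gamma>\<^esub>) = x \<otimes>\<^bsub>\<Gamma>\<^esub> \<sigma> \<one>\<^bsub>\<Gamma>\<^esub>"
        by blast
      then show ?thesis
        using x \<sigma> by (simp add: m_comm)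
    qed
    have "\<sigma> = translation \<Gamma> (\<sigma> \<one>\<^bsub>\<Gamma>\<^esub>)"
    proof (rule extensionalityI[OF ext])
      show "translation \<Gamma> (\<sigma> \<one>\<^bsub>\<Gamma>\<^esub>) \<in> extensional (carrier \<Gamma>)"
        by (simp add: translation_def)
      fix x assume "x \<in> carrier \<Gamma>"
      then show "\<sigma> x = translation \<Gamma> (\<sigma> \<one>\<^bsub>\<Gamma>\<^esub>) x"
        using eq translation_apply by metis
    qed
    then show ?thesis
      using \<sigma> by blast
  qed
  have "inj_on (translation \<Gamma>) (carrier \<Gamma>)"
  proof (rule inj_onI)
    fix a b assume ab: "a \<in> carrier \<Gamma>" "b \<in> carrier \<Gamma>" and "translation \<Gamma> a = translation \<Gamma> b"
    then have "translation \<Gamma> a \<one>\<^bsub>\<Gamma>\<^esub> = translation \<Gamma> b \<one>\<^bsub>\<Gamma>\<^esub>"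
      by simp
    with ab show "a = b"
      by (simp add: translation_apply)
  qed
  then show ?thesis
    using Aut mult surj bij
    by (auto simp: iso_def hom_def bij_betw_def Aut_group_def BijGroup_def)
qed


subsection \<open>Isomorphisms of translation families\<close>

lemma isomorphic_translation_families_if:
  assumes \<Gamma>: "generated_abelian_group_on X I \<Gamma> \<gamma>" and \<Gamma>': "generated_abelian_group_on X I \<Gamma>' \<gamma>'"
    and iso: "isomorphic_generated_groups I \<Gamma> \<gamma> \<Gamma>' \<gamma>'"
  shows "isomorphic_families X I (translation_family \<Gamma> \<gamma>) (translation_family \<Gamma>' \<gamma>')"
proof -
  from \<Gamma> interpret comm_group \<Gamma>
    by (simp add: generated_abelian_group_on_def)
  from \<Gamma> \<Gamma>' have X: "carrier \<Gamma> = X" "carrier \<Gamma>' = X" and \<gamma>: "\<And>i. i \<in> I \<Longrightarrow> \<gamma> i \<in> carrier \<Gamma>"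
    by (auto simp: generated_abelian_group_on_def)
  from iso obtain h where h: "h \<in> iso \<Gamma> \<Gamma>'" and h\<gamma>: "\<And>i. i \<in> I \<Longrightarrow> h (\<gamma> i) = \<gamma>' i"
    unfolding isomorphic_generated_groups_def by blast
  have hom: "h \<in> hom \<Gamma> \<Gamma>'" and bij: "bij_betw h X X"
    using h X by (auto simp: iso_def)
  have hX: "h x \<in> carrier \<Gamma>'" if "x \<in> carrier \<Gamma>" for x
    using hom that by (rule hom_in_carrier)
  show ?thesis
    unfolding isomorphic_families_iff
  proof (intro bexI ballI)
    \<comment> \<open>Members of \<open>iso\<close> may take any values off the carrier, while those
      of \<open>Bij X\<close> are extensional; hence the restriction.\<close>
    show "restrict h X \<in> Bij X"
      using bij by (simp add: Bij_def bij_betw_restrict_eq)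
    fix i x assume ix: "i \<in> I" "x \<in> X"
    have "restrict h X (translation_family \<Gamma> \<gamma> i x) = h (\<gamma> i \<otimes>\<^bsub>\<Gamma>\<^esub> x)"
      using ix \<gamma> X m_closed[of "\<gamma> i" x] by (simp add: translation_family_apply)
    also have "\<dots> = \<gamma>' i \<otimes>\<^bsub>\<Gamma>'\<^esub> h x"
      using hom_mult[OF hom] ix \<gamma> h\<gamma> X by simp
    also have "\<dots> = translation_family \<Gamma>' \<gamma>' i (restrict h X x)"
      using ix hX X by (simp add: translation_family_apply)
    finally show "restrict h X (translation_family \<Gamma> \<gamma> i x)
      = translation_family \<Gamma>' \<gamma>' i (restrict h X x)" .
  qed
qed

text \<open>An isomorphism \<sigma> of the families need not preserve the identity. Following it by
  a translation of \<Gamma>' corrects this and keeps the intertwining property, since \<Gamma>' is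
  commutative; the result is a homomorphism because it is multiplicative against generators.\<close>

lemma isomorphic_generated_groups_if:
  assumes \<Gamma>: "generated_abelian_group_on X I \<Gamma> \<gamma>" and \<Gamma>': "generated_abelian_group_on X I \<Gamma>' \<gamma>'"
    and iso: "isomorphic_families X I (translation_family \<Gamma> \<gamma>) (translation_family \<Gamma>' \<gamma>')"
  shows "isomorphic_generated_groups I \<Gamma> \<gamma> \<Gamma>' \<gamma>'"
proof -
  from \<Gamma> interpret G: comm_group \<Gamma>
    by (simp add: generated_abelian_group_on_def)
  from \<Gamma>' interpret H: comm_group \<Gamma>'
    by (simp add: generated_abelian_group_on_def)
  from \<Gamma> have X: "X = carrier \<Gamma>" and \<gamma>: "\<And>i. i \<in> I \<Longrightarrow> \<gamma> i \<in> carrier \<Gamma>"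
    and gen: "generates_as_monoid \<Gamma> I \<gamma>"
    by (auto simp: generated_abelian_group_on_def)
  from \<Gamma>' have X': "X = carrier \<Gamma>'" and \<gamma>': "\<And>i. i \<in> I \<Longrightarrow> \<gamma>' i \<in> carrier \<Gamma>'"
    by (auto simp: generated_abelian_group_on_def)
  from iso obtain \<sigma> where "\<sigma> \<in> Bij X"
    and eq: "\<And>i x. i \<in> I \<Longrightarrow> x \<in> X \<Longrightarrow>
      \<sigma> (translation_family \<Gamma> \<gamma> i x) = translation_family \<Gamma>' \<gamma>' i (\<sigma> x)"
    unfolding isomorphic_families_iff by blast
  then have bij: "bij_betw \<sigma> (carrier \<Gamma>) (carrier \<Gamma>')"
    using X X' by (auto simp: Bij_def)
  have \<sigma>: "\<sigma> x \<in> carrier \<Gamma>'" if "x \<in> carrier \<Gamma>" for x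
    using bij that by (auto simp: bij_betw_def)
  have eq: "\<sigma> (\<gamma> i \<otimes>\<^bsub>\<Gamma>\<^esub> x) = \<gamma>' i \<otimes>\<^bsub>\<Gamma>'\<^esub> \<sigma> x" if "i \<in> I" "x \<in> carrier \<Gamma>" for i x
    using eq[of i x] that \<sigma> X by (simp add: translation_family_apply)
  \<comment> \<open>Chosen so that \<open>h\<close> sends identity to identity.\<close>
  define c where "c = inv\<^bsub>\<Gamma>'\<^esub> \<sigma> \<one>\<^bsub>\<Gamma>\<^esub>"
  define h where "h = (\<lambda>x. c \<otimes>\<^bsub>\<Gamma>'\<^esub> \<sigma> x)"
  have c: "c \<in> carrier \<Gamma>'" and c1: "c \<otimes>\<^bsub>\<Gamma>'\<^esub> \<sigma> \<one>\<^bsub>\<Gamma>\<^esub> = \<one>\<^bsub>\<Gamma>'\<^esub>"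
    using \<sigma> by (simp_all add: c_def)
  have h: "h x \<in> carrier \<Gamma>'" if "x \<in> carrier \<Gamma>" for x
    using c \<sigma> that by (simp add: h_def)
  have h\<gamma>: "h (\<gamma> i) = \<gamma>' i" if i: "i \<in> I" for i
  proof -
    have "h (\<gamma> i) = c \<otimes>\<^bsub>\<Gamma>'\<^esub> (\<gamma>' i \<otimes>\<^bsub>\<Gamma>'\<^esub> \<sigma> \<one>\<^bsub>\<Gamma>\<^esub>)"
      using eq[OF i, of "\<one>\<^bsub>\<Gamma>\<^esub>"] \<gamma> i by (simp add: h_def)
    also have "\<dots> = \<gamma>' i \<otimes>\<^bsub>\<Gamma>'\<^esub> (c \<otimes>\<^bsub>\<Gamma>'\<^esub> \<sigma> \<one>\<^bsub>\<Gamma>\<^esub>)"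
      using c \<sigma> \<gamma>' i by (simp add: H.m_lcomm)
    finally show ?thesis
      using \<gamma>' i by (simp add: c1)
  qed
  \<comment> \<open>Multiplicativity is required for a fixed left factor and all right factors,
    which makes the condition stable under products by associativity.\<close>
  let ?S = "{a \<in> carrier \<Gamma>. \<forall>x\<in>carrier \<Gamma>. h (a \<otimes>\<^bsub>\<Gamma>\<^esub> x) = h a \<otimes>\<^bsub>\<Gamma>'\<^esub> h x}"
  have "submonoid ?S \<Gamma>"
  proof
    have "h \<one>\<^bsub>\<Gamma>\<^esub> = \<one>\<^bsub>\<Gamma>'\<^esub>"
      by (simp add: h_def c1)
    then show "\<one>\<^bsub>\<Gamma>\<^esub> \<in> ?S"
      using h by simp
  qed (auto simp: h G.m_assoc H.m_assoc)
  moreover have "h (\<gamma> i \<otimes>\<^bsub>\<Gamma>\<^esub> x) = h (\<gamma> i) \<otimes>\<^bsub>\<Gamma>'\<^esub> h x" if "i \<in> I" "x \<in> carrier \<Gamma>" for i x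
    using that eq[OF that] c \<sigma> \<gamma>' h\<gamma> by (simp add: h_def H.m_lcomm)
  then have "\<gamma> ` I \<subseteq> ?S"
    using \<gamma> by auto
  ultimately have S: "?S = carrier \<Gamma>"
    by (rule submonoid_eq_carrier[OF gen])
  have "h \<in> hom \<Gamma> \<Gamma>'"
  proof (rule homI)
    fix x y assume "x \<in> carrier \<Gamma>" "y \<in> carrier \<Gamma>"
    then show "h (x \<otimes>\<^bsub>\<Gamma>\<^esub> y) = h x \<otimes>\<^bsub>\<Gamma>'\<^esub> h y"
      using S by blast
  qed (rule h)
  moreover have "bij_betw h (carrier \<Gamma>) (carrier \<Gamma>')"
  proof -
    \<comment> \<open>On the carrier, \<open>h\<close> is \<sigma> followed by the translation by
      \<open>c\<close>, a composite of two bijections.\<close>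
    have "bij_betw (translation \<Gamma>' c) (carrier \<Gamma>') (carrier \<Gamma>')"
      using translation_in_Bij[OF H.is_group c] by (simp add: Bij_def)
    then have "bij_betw (translation \<Gamma>' c \<circ> \<sigma>) (carrier \<Gamma>) (carrier \<Gamma>')"
      by (rule bij_betw_trans[OF bij])
    then show ?thesis
      by (rule bij_betw_cong[THEN iffD1, rotated]) (simp add: h_def translation_apply \<sigma>)
  qed
  ultimately show ?thesis
    using h\<gamma> unfolding isomorphic_generated_groups_def iso_def by blast
qed


subsection \<open>The group of a commuting incompressible family\<close>

text \<open>The monoid \<open>M\<close> of the introduction, as words extended on the left by one
  family member at a time. Inductions then treat a single \<open>f i\<close>, and closure under
  composition becomes a lemma.\<close>

inductive_set generated_maps :: "'a set \<Rightarrow> 'i set \<Rightarrow> ('i \<Rightarrow> 'a \<Rightarrow> 'a) \<Rightarrow> ('a \<Rightarrow> 'a) set"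
  for X I f where
  identity: "(\<lambda>x\<in>X. x) \<in> generated_maps X I f"
| step: "i \<in> I \<Longrightarrow> m \<in> generated_maps X I f \<Longrightarrow> compose X (f i) m \<in> generated_maps X I f"

context
  fixes X :: "'a set" and I :: "'i set" and f :: "'i \<Rightarrow> 'a \<Rightarrow> 'a"
  assumes ci: "commuting_incompressible X I f"
begin

lemma family_closed: "i \<in> I \<Longrightarrow> x \<in> X \<Longrightarrow> f i x \<in> X"
  using ci by (auto simp: commuting_incompressible_def self_map_family_def PiE_iff)

lemma family_extensional: "i \<in> I \<Longrightarrow> f i \<in> extensional X"
  using ci by (auto simp: commuting_incompressible_def self_map_family_def PiE_iff)

lemma family_commute: "i \<in> I \<Longrightarrow> j \<in> I \<Longrightarrow> x \<in> X \<Longrightarrow> f i (f j x) = f j (f i x)"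
  using ci by (auto simp: commuting_incompressible_def commuting_def compose_eq_iff)

text \<open>The form in which incompressibility is used: once for orbits of the generated monoid,
  once for submonoids of the group constructed on \<open>X\<close>.\<close>

lemma invariant_eq:
  "J \<noteq> {} \<Longrightarrow> J \<subseteq> X \<Longrightarrow> (\<And>i x. i \<in> I \<Longrightarrow> x \<in> J \<Longrightarrow> f i x \<in> J) \<Longrightarrow> J = X"
  using ci unfolding commuting_incompressible_def incompressible_def
  by (metis image_subsetI psubsetI)

lemma generated_maps_closed: "m \<in> generated_maps X I f \<Longrightarrow> x \<in> X \<Longrightarrow> m x \<in> X"
  by (induction rule: generated_maps.induct) (auto simp: compose_eq family_closed)

lemma generated_maps_extensional: "m \<in> generated_maps X I f \<Longrightarrow> m \<in> extensional X"
  by (induction rule: generated_maps.induct)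
    (simp_all only: restrict_extensional compose_extensional)

lemma family_in_generated_maps:
  assumes "i \<in> I"
  shows "f i \<in> generated_maps X I f"
proof -
  have "compose X (f i) (\<lambda>x\<in>X. x) = f i"
    using assms family_extensional
    by (intro extensionalityI[where A = X] compose_extensional) (simp_all add: compose_eq)
  then show ?thesis
    using generated_maps.step[OF assms generated_maps.identity, of X f] by simp
qed

lemma compose_in_generated_maps:
  "m \<in> generated_maps X I f \<Longrightarrow> n \<in> generated_maps X I f \<Longrightarrow> compose X m n \<in> generated_maps X I f"
proof (induction rule: generated_maps.induct)
  case identity
  have "compose X (\<lambda>x\<in>X. x) n = n"
    using identity generated_maps_closed generated_maps_extensional
    by (intro extensionalityI[where A = X] compose_extensional) (simp_all add: compose_eq)
  with identity show ?case by metis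
next
  case (step i m)
  have "compose X (compose X (f i) m) n = compose X (f i) (compose X m n)"
    using step.prems generated_maps_closed
    by (intro extensionalityI[where A = X] compose_extensional) (simp_all add: compose_eq)
  with step show ?case by (simp add: generated_maps.step)
qed

text \<open>Commutativity passes from the family to the monoid in two inductions: here one argument
  is generalised to a word, in the next lemma the other.\<close>

lemma generated_maps_commute_family:
  "m \<in> generated_maps X I f \<Longrightarrow> i \<in> I \<Longrightarrow> x \<in> X \<Longrightarrow> m (f i x) = f i (m x)"
  by (induction rule: generated_maps.induct)
    (simp_all add: compose_eq family_closed family_commute generated_maps_closed)

lemma generated_maps_commute:
  "m \<in> generated_maps X I f \<Longrightarrow> n \<in> generated_maps X I f \<Longrightarrow> x \<in> X \<Longrightarrow> m (n x) = n (m x)"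
  by (induction rule: generated_maps.induct)
    (simp_all add: compose_eq generated_maps_closed generated_maps_commute_family)

text \<open>The orbit of \<open>x\<close> is non-empty because of the identity and invariant because
  words extend on the left.\<close>

lemma generated_maps_transitive:
  assumes x: "x \<in> X" and y: "y \<in> X"
  obtains m where "m \<in> generated_maps X I f" and "m x = y"
proof -
  have "(\<lambda>m. m x) ` generated_maps X I f = X"
  proof (rule invariant_eq)
    show "(\<lambda>m. m x) ` generated_maps X I f \<noteq> {}"
      using generated_maps.identity by blast
    show "(\<lambda>m. m x) ` generated_maps X I f \<subseteq> X"
      using x generated_maps_closed by blast
    fix i z assume i: "i \<in> I" and "z \<in> (\<lambda>m. m x) ` generated_maps X I f"
    then obtain m where m: "m \<in> generated_maps X I f" "z = m x"
      by blast
    then have "f i z = compose X (f i) m x"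
      using x by (simp add: compose_eq)
    then show "f i z \<in> (\<lambda>m. m x) ` generated_maps X I f"
      using generated_maps.step[OF i m(1)] by blast
  qed
  with y have "y \<in> (\<lambda>m. m x) ` generated_maps X I f"
    by simp
  then show ?thesis
    using that by (elim imageE) simp
qed

text \<open>Any other point is \<open>k x\<close> with \<open>k\<close> in the monoid, and both maps
  commute with \<open>k\<close>, so their agreement at \<open>x\<close> spreads to all of
  \<open>X\<close>.\<close>

lemma generated_maps_eqI:
  assumes m: "m \<in> generated_maps X I f" and n: "n \<in> generated_maps X I f"
    and x: "x \<in> X" and eq: "m x = n x"
  shows "m = n"
proof (rule extensionalityI[OF generated_maps_extensional[OF m] generated_maps_extensional[OF n]])
  fix y assume "y \<in> X"
  then obtain k where k: "k \<in> generated_maps X I f" "k x = y"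
    using x generated_maps_transitive by blast
  have "m y = k (m x)"
    using generated_maps_commute[OF m k(1) x] k by simp
  also have "\<dots> = n y"
    using generated_maps_commute[OF n k(1) x] k eq by simp
  finally show "m y = n y" .
qed

text \<open>The base point \<open>x0\<close> becomes the identity, and \<open>T x\<close> is the
  unique generated map sending \<open>x0\<close> to \<open>x\<close>. The product of
  \<open>x\<close> and \<open>y\<close> is \<open>T x y\<close>, the value at \<open>x0\<close> of
  the composite of \<open>T x\<close> and \<open>T y\<close>. The family equals the translation
  family on \<open>I\<close>, not merely up to isomorphism.\<close>

lemma commuting_incompressible_eq_translation_family:
  assumes x0: "x0 \<in> X"
  obtains \<Gamma> :: "'a monoid" and \<gamma> :: "'i \<Rightarrow> 'a"
  where "generated_abelian_group_on X I \<Gamma> \<gamma>" and "\<And>i. i \<in> I \<Longrightarrow> f i = translation_family \<Gamma> \<gamma> i"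
proof -
  let ?M = "generated_maps X I f"
  have "\<forall>x\<in>X. \<exists>m\<in>?M. m x0 = x"
    using x0 generated_maps_transitive by metis
  then obtain T where TM: "\<And>x. x \<in> X \<Longrightarrow> T x \<in> ?M" and T0: "\<And>x. x \<in> X \<Longrightarrow> T x x0 = x"
    by metis
  have T_closed: "T x y \<in> X" if "x \<in> X" "y \<in> X" for x y
    using that TM generated_maps_closed by blast
  \<comment> \<open>By uniqueness, \<open>T\<close> inverts evaluation at \<open>x0\<close>; the
    group laws below reduce to properties of composition through this.\<close>
  have T_eq: "T (m x0) = m" if "m \<in> ?M" for m
    using that x0 TM T0 generated_maps_closed generated_maps_eqI by metis
  define \<Gamma> :: "'a monoid" where "\<Gamma> = \<lparr>carrier = X, mult = T, one = x0\<rparr>"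
  define \<gamma> where "\<gamma> = (\<lambda>i. f i x0)"
  have carrier: "carrier \<Gamma> = X" and mult: "\<And>x y. x \<otimes>\<^bsub>\<Gamma>\<^esub> y = T x y" and one: "\<one>\<^bsub>\<Gamma>\<^esub> = x0"
    by (simp_all add: \<Gamma>_def)
  have T_assoc: "T (T x y) z = T x (T y z)" if xyz: "x \<in> X" "y \<in> X" "z \<in> X" for x y z
  proof -
    \<comment> \<open>The composite sends \<open>x0\<close> to \<open>T x y\<close>, so it is
      \<open>T (T x y)\<close>; evaluation at \<open>z\<close> gives associativity.\<close>
    have "T (compose X (T x) (T y) x0) = compose X (T x) (T y)"
      using xyz by (intro T_eq compose_in_generated_maps TM)
    then show ?thesis
      using xyz x0 T0 by (simp add: compose_def fun_eq_iff)
  qed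
  have T_comm: "T x y = T y x" if xy: "x \<in> X" "y \<in> X" for x y
    using generated_maps_commute[OF TM[OF xy(1)] TM[OF xy(2)] x0] xy T0 by simp
  have T_one: "T x0 x = x" if "x \<in> X" for x
    using that T_comm[OF x0 that] T0 by simp
  have T_inv: "\<exists>y\<in>X. T y x = x0" if x: "x \<in> X" for x
  proof -
    \<comment> \<open>Inverses come from transitivity: a map \<open>n\<close> returning
      \<open>x\<close> to \<open>x0\<close> is translation by \<open>n x0\<close>, which is
      therefore the inverse of \<open>x\<close>.\<close>
    obtain n where n: "n \<in> ?M" "n x = x0"
      using generated_maps_transitive[OF x x0] by blast
    then have "T (n x0) x = x0"
      using T_eq by simp
    then show ?thesis
      using n x0 generated_maps_closed by blast
  qed
  have grp: "comm_group \<Gamma>"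
    by (rule comm_groupI) (auto simp: carrier mult one x0 T_closed T_assoc T_one T_inv dest: T_comm)
  have translation: "f i = translation_family \<Gamma> \<gamma> i" if i: "i \<in> I" for i
    using T_eq[OF family_in_generated_maps[OF i]] family_extensional[OF i]
    by (intro extensionalityI[where A = X])
      (simp_all add: translation_family_def translation_def carrier mult \<gamma>_def)
  have "generates_as_monoid \<Gamma> I \<gamma>"
  proof -
    \<comment> \<open>A submonoid containing the \<gamma> \<open>i\<close> is invariant under
      translation by them, that is, under the family, so incompressibility applies.\<close>
    have "S = X" if "submonoid S \<Gamma>" and \<gamma>S: "\<gamma> ` I \<subseteq> S" for S
    proof -
      interpret submonoid S \<Gamma> by fact
      show ?thesis
      proof (rule invariant_eq)
        show "S \<noteq> {}"
          using one_closed by blast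
        show "S \<subseteq> X"
          using subset carrier by simp
        fix i x assume ix: "i \<in> I" "x \<in> S"
        then have "f i x = \<gamma> i \<otimes>\<^bsub>\<Gamma>\<^esub> x"
          using translation subset by (auto simp: translation_family_apply)
        then show "f i x \<in> S"
          using ix \<gamma>S by auto
      qed
    qed
    moreover have "submonoid X \<Gamma>"
      by unfold_locales (auto simp: carrier mult one x0 T_closed)
    moreover have "\<gamma> ` I \<subseteq> X"
      using x0 family_closed by (auto simp: \<gamma>_def)
    ultimately have "{S. submonoid S \<Gamma> \<and> \<gamma> ` I \<subseteq> S} = {X}"
      by blast
    then show ?thesis
      by (simp add: generates_as_monoid_def carrier)
  qed
  then have "generated_abelian_group_on X I \<Gamma> \<gamma>"
    using grp x0 family_closed by (auto simp: generated_abelian_group_on_def carrier \<gamma>_def)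
  then show ?thesis
    using translation by (rule that)
qed

end

section \<open>The automorphism group of a family\<close>

text \<open>Commutation is stable under composition, and it passes to the inverse of \<sigma> by
  cancelling the injective \<sigma>.\<close>

lemma Aut_subgroup:
  assumes "self_map_family X I f"
  shows "subgroup (Aut X I f) (BijGroup X)"
proof -
  have f: "f i x \<in> X" if "i \<in> I" "x \<in> X" for i x
    using assms that by (auto simp: self_map_family_def PiE_iff)
  have Bij_closed: "\<sigma> x \<in> X" if "\<sigma> \<in> Bij X" "x \<in> X" for \<sigma> x
    using that by (auto simp: Bij_def bij_betw_def)
  show ?thesis
  proof (rule group.subgroupI[OF group_BijGroup])
    show "Aut X I f \<subseteq> carrier (BijGroup X)"
      by (auto simp: mem_Aut_iff BijGroup_def)
    have "(\<lambda>x\<in>X. x) \<in> Aut X I f"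
      using f by (auto simp: mem_Aut_iff id_Bij)
    then show "Aut X I f \<noteq> {}"
      by blast
  next
    fix \<sigma> assume \<sigma>: "\<sigma> \<in> Aut X I f"
    then have bij: "\<sigma> \<in> Bij X"
      by (simp add: mem_Aut_iff)
    let ?\<tau> = "\<lambda>x\<in>X. inv_into X \<sigma> x"
    have \<tau>: "?\<tau> x \<in> X" "\<sigma> (?\<tau> x) = x" if "x \<in> X" for x
      using that bij by (auto simp: Bij_def bij_betw_def inv_into_into f_inv_into_f)
    have "?\<tau> (f i x) = f i (?\<tau> x)" if ix: "i \<in> I" "x \<in> X" for i x
    proof (rule inj_onD[where f = \<sigma> and A = X])
      show "inj_on \<sigma> X"
        using bij by (simp add: Bij_def bij_betw_def)
      have "\<sigma> (f i (?\<tau> x)) = f i (\<sigma> (?\<tau> x))"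
        using \<sigma> ix \<tau>(1)[OF ix(2)] unfolding mem_Aut_iff by blast
      then show "\<sigma> (?\<tau> (f i x)) = \<sigma> (f i (?\<tau> x))"
        using \<tau>(2)[OF f[OF ix]] \<tau>(2)[OF ix(2)] by metis
    qed (use f ix \<tau>(1) in blast)+
    then show "inv\<^bsub>BijGroup X\<^esub> \<sigma> \<in> Aut X I f"
      unfolding inv_BijGroup[OF bij] mem_Aut_iff
      using restrict_inv_into_Bij[OF bij] by blast
  next
    fix \<sigma> \<tau> assume st: "\<sigma> \<in> Aut X I f" "\<tau> \<in> Aut X I f"
    then have "\<sigma> \<otimes>\<^bsub>BijGroup X\<^esub> \<tau> = compose X \<sigma> \<tau>"
      by (simp add: BijGroup_def mem_Aut_iff)
    moreover have "compose X \<sigma> \<tau> \<in> Aut X I f"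
      using st f by (auto simp: mem_Aut_iff compose_Bij compose_eq Bij_closed)
    ultimately show "\<sigma> \<otimes>\<^bsub>BijGroup X\<^esub> \<tau> \<in> Aut X I f"
      by simp
  qed
qed

text \<open>Conjugating automorphism groups is avoided: \<open>f\<close> equals the translation family of some
  group \<open>\<Gamma>\<^sub>0\<close> on the nose, and \<open>\<Gamma>\<^sub>0\<close> is isomorphic to \<open>\<Gamma>\<close>.\<close>

lemma group_iso_Aut_group:
  fixes f :: "'i \<Rightarrow> 'a \<Rightarrow> 'a" and \<Gamma> :: "'a monoid" and \<gamma> :: "'i \<Rightarrow> 'a"
  assumes ci: "commuting_incompressible X I f" and \<Gamma>: "generated_abelian_group_on X I \<Gamma> \<gamma>"
    and iso: "isomorphic_families X I f (translation_family \<Gamma> \<gamma>)"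
  shows "\<Gamma> \<cong> Aut_group X I f"
proof -
  from \<Gamma> interpret comm_group \<Gamma>
    by (simp add: generated_abelian_group_on_def)
  \<comment> \<open>Supplies the base point for the construction of
    \<open>\<Gamma>\<^sub>0\<close>.\<close>
  have "\<one>\<^bsub>\<Gamma>\<^esub> \<in> X"
    using \<Gamma> one_closed by (simp add: generated_abelian_group_on_def)
  then obtain \<Gamma>\<^sub>0 :: "'a monoid" and \<gamma>\<^sub>0 where \<Gamma>\<^sub>0: "generated_abelian_group_on X I \<Gamma>\<^sub>0 \<gamma>\<^sub>0"
    and f: "\<And>i. i \<in> I \<Longrightarrow> f i = translation_family \<Gamma>\<^sub>0 \<gamma>\<^sub>0 i"
    using commuting_incompressible_eq_translation_family[OF ci] by metis
  have "isomorphic_families X I (translation_family \<Gamma>\<^sub>0 \<gamma>\<^sub>0) (translation_family \<Gamma> \<gamma>)"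
    using iso isomorphic_families_cong[of I f "translation_family \<Gamma>\<^sub>0 \<gamma>\<^sub>0"] f by metis
  then have "\<Gamma>\<^sub>0 \<cong> \<Gamma>"
    using isomorphic_generated_groups_if[OF \<Gamma>\<^sub>0 \<Gamma>]
    by (auto simp: isomorphic_generated_groups_def is_iso_def)
  then have "\<Gamma> \<cong> \<Gamma>\<^sub>0"
    using \<Gamma>\<^sub>0 by (auto simp: generated_abelian_group_on_def comm_group_def intro: group.iso_sym)
  also have "\<Gamma>\<^sub>0 \<cong> Aut_group X I f"
    using translation_iso_Aut_group[OF \<Gamma>\<^sub>0] Aut_cong[of I f "translation_family \<Gamma>\<^sub>0 \<gamma>\<^sub>0" X] f
    by (auto simp: is_iso_def Aut_group_def)
  finally show ?thesis .
qed

text \<open>The first three conjuncts make the correspondence well defined, surjective and injective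
  on isomorphism classes. The last three make the automorphisms a permutation group, identify them
  with the translations, and carry this to every family isomorphic to a translation family. The
  empty set is excluded: its families are vacuously commuting and incompressible, but it carries no
  group.\<close>

theorem theorem2p7:
  fixes X :: "'a set" and I :: "'i set"
  assumes "X \<noteq> {}"
  shows
    "((\<forall>(\<Gamma> :: 'a monoid) (\<gamma> :: 'i \<Rightarrow> 'a). generated_abelian_group_on X I \<Gamma> \<gamma> \<longrightarrow>
         commuting_incompressible X I (translation_family \<Gamma> \<gamma>)) \<and>
      (\<forall>f :: 'i \<Rightarrow> 'a \<Rightarrow> 'a. commuting_incompressible X I f \<longrightarrow>
         (\<exists>(\<Gamma> :: 'a monoid) (\<gamma> :: 'i \<Rightarrow> 'a). generated_abelian_group_on X I \<Gamma> \<gamma> \<and>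
            isomorphic_families X I f (translation_family \<Gamma> \<gamma>))) \<and>
      (\<forall>(\<Gamma> :: 'a monoid) (\<gamma> :: 'i \<Rightarrow> 'a) (\<Gamma>' :: 'a monoid) (\<gamma>' :: 'i \<Rightarrow> 'a).
         generated_abelian_group_on X I \<Gamma> \<gamma> \<and> generated_abelian_group_on X I \<Gamma>' \<gamma>' \<longrightarrow>
         (isomorphic_families X I (translation_family \<Gamma> \<gamma>) (translation_family \<Gamma>' \<gamma>') \<longleftrightarrow>
          isomorphic_generated_groups I \<Gamma> \<gamma> \<Gamma>' \<gamma>')))
     \<and>
     ((\<forall>f :: 'i \<Rightarrow> 'a \<Rightarrow> 'a. commuting_incompressible X I f \<longrightarrow>
         subgroup (Aut X I f) (BijGroup X)) \<and>
      (\<forall>(\<Gamma> :: 'a monoid) (\<gamma> :: 'i \<Rightarrow> 'a). generated_abelian_group_on X I \<Gamma> \<gamma> \<longrightarrow>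
         translation \<Gamma> \<in> iso \<Gamma> (Aut_group X I (translation_family \<Gamma> \<gamma>))) \<and>
      (\<forall>(f :: 'i \<Rightarrow> 'a \<Rightarrow> 'a) (\<Gamma> :: 'a monoid) (\<gamma> :: 'i \<Rightarrow> 'a).
         commuting_incompressible X I f \<and> generated_abelian_group_on X I \<Gamma> \<gamma> \<and>
         isomorphic_families X I f (translation_family \<Gamma> \<gamma>) \<longrightarrow>
         \<Gamma> \<cong> Aut_group X I f))"
proof (intro conjI allI impI)
  show "commuting_incompressible X I (translation_family \<Gamma> \<gamma>)"
    if "generated_abelian_group_on X I \<Gamma> \<gamma>" for \<Gamma> :: "'a monoid" and \<gamma> :: "'i \<Rightarrow> 'a"
    using that by (rule translation_family_commuting_incompressible)
  show "\<exists>(\<Gamma> :: 'a monoid) (\<gamma> :: 'i \<Rightarrow> 'a). generated_abelian_group_on X I \<Gamma> \<gamma> \<and>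
      isomorphic_families X I f (translation_family \<Gamma> \<gamma>)"
    if ci: "commuting_incompressible X I f" for f :: "'i \<Rightarrow> 'a \<Rightarrow> 'a"
  proof -
    obtain x0 where x0: "x0 \<in> X"
      using assms by blast
    obtain \<Gamma> :: "'a monoid" and \<gamma> where "generated_abelian_group_on X I \<Gamma> \<gamma>"
      and f: "\<And>i. i \<in> I \<Longrightarrow> f i = translation_family \<Gamma> \<gamma> i"
      using commuting_incompressible_eq_translation_family[OF ci x0] by metis
    moreover have "isomorphic_families X I f (translation_family \<Gamma> \<gamma>)"
      using ci f by (intro isomorphic_families_refl) (simp_all add: commuting_incompressible_def)
    ultimately show ?thesis
      by blast
  qed
  show "isomorphic_families X I (translation_family \<Gamma> \<gamma>) (translation_family \<Gamma>' \<gamma>') \<longleftrightarrow>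
      isomorphic_generated_groups I \<Gamma> \<gamma> \<Gamma>' \<gamma>'"
    if "generated_abelian_group_on X I \<Gamma> \<gamma> \<and> generated_abelian_group_on X I \<Gamma>' \<gamma>'"
    for \<Gamma> \<Gamma>' :: "'a monoid" and \<gamma> \<gamma>' :: "'i \<Rightarrow> 'a"
    using that isomorphic_translation_families_if isomorphic_generated_groups_if by metis
  show "subgroup (Aut X I f) (BijGroup X)"
    if "commuting_incompressible X I f" for f :: "'i \<Rightarrow> 'a \<Rightarrow> 'a"
    using that by (simp add: Aut_subgroup commuting_incompressible_def)
  show "translation \<Gamma> \<in> iso \<Gamma> (Aut_group X I (translation_family \<Gamma> \<gamma>))"
    if "generated_abelian_group_on X I \<Gamma> \<gamma>" for \<Gamma> :: "'a monoid" and \<gamma> :: "'i \<Rightarrow> 'a"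
    using that by (rule translation_iso_Aut_group)
  show "\<Gamma> \<cong> Aut_group X I f"
    if "commuting_incompressible X I f \<and> generated_abelian_group_on X I \<Gamma> \<gamma> \<and>
      isomorphic_families X I f (translation_family \<Gamma> \<gamma>)"
    for f :: "'i \<Rightarrow> 'a \<Rightarrow> 'a" and \<Gamma> :: "'a monoid" and \<gamma> :: "'i \<Rightarrow> 'a"
    using that group_iso_Aut_group by metis
qed

end
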